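(* Let $Q=\{x\in\mathbb{R}^n_+\mid Ax\ge b,\ x\le u\}$ be a non-empty covering polyhedron with bounds. Then its integer hull $Q^I$ is a covering polyhedron with bounds. Moreover, $Q^I$ has the same upper bounds as $Q$, namely $Q^I=\{x\in\mathbb{R}^n_+\mid A'x\ge b',\ x\le u\}$ for some $(A',b')$ (non-negative and rational).
   Context: A covering polyhedron with bounds is a set $\{x\in\mathbb{R}^n_+\mid Ax\ge b,\ x\le u\}$ with $A,b$ rational and entrywise non-negative and each component of $u$ either a non-negative integer or $+\infty$. $Q^I=\operatorname{conv}(Q\cap\mathbb{Z}^n)$. *)

theory Defs
  imports "HOL-Analysis.Analysis"
begin

text \<open>
  An \<open>m \<times> n\<close> matrix is given by its rows \<open>A 0, \<dots>, A (m - 1)\<close>, so that the number of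
  rows can be existentially quantified; values of \<open>A\<close> and \<open>b\<close> at indices \<open>\<ge> m\<close> are irrelevant.
  The bounds have type \<^typ>\<open>enat\<close>: each one is a non-negative integer or \<open>\<infinity>\<close>.
\<close>

definition nonneg_rational_system :: "nat \<Rightarrow> (nat \<Rightarrow> real ^ 'n) \<Rightarrow> (nat \<Rightarrow> real) \<Rightarrow> bool" where
  "nonneg_rational_system m A b \<longleftrightarrow>
     (\<forall>i<m. (\<forall>j. A i $ j \<in> \<rat> \<and> 0 \<le> A i $ j) \<and> b i \<in> \<rat> \<and> 0 \<le> b i)"

definition polyhedron_with_bounds ::
    "nat \<Rightarrow> (nat \<Rightarrow> real ^ 'n) \<Rightarrow> (nat \<Rightarrow> real) \<Rightarrow> enat ^ 'n \<Rightarrow> (real ^ 'n) set" where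
  "polyhedron_with_bounds m A b u =
     {x. (\<forall>j. 0 \<le> x $ j) \<and> (\<forall>i<m. A i \<bullet> x \<ge> b i) \<and> (\<forall>j. ereal (x $ j) \<le> ereal_of_enat (u $ j))}"

definition covering_polyhedron_with_bounds :: "(real ^ 'n) set \<Rightarrow> bool" where
  "covering_polyhedron_with_bounds Q \<longleftrightarrow>
     (\<exists>m A b u. nonneg_rational_system m A b \<and> Q = polyhedron_with_bounds m A b u)"

definition integer_hull :: "(real ^ 'n) set \<Rightarrow> (real ^ 'n) set" where
  "integer_hull Q = convex hull (Q \<inter> {x. \<forall>j. x $ j \<in> \<int>})"

end

theory Submission
  imports Defs
begin

text \<open>
  For a large integer \<open>N\<close>, truncating all coordinates at \<open>N\<close> maps integer points of \<open>Q\<close> to integer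
  points of \<open>Q\<close>, because the coefficients are non-negative. Hence every integer point of \<open>Q\<close>
  dominates one of the finite set \<open>V\<close> of integer points of \<open>Q\<close> in \<open>[0, N]\<^sup>n\<close>. Fourier--Motzkin
  elimination describes \<open>conv V + \<real>\<^sup>n\<^sub>+\<close> by finitely many rational inequalities; starting from
  \<open>x \<ge> 0\<close>, it only ever takes non-negative combinations, so the coefficients of \<open>x\<close> remain
  non-negative. Finally \<open>Q\<^sup>I\<close> is closed under increasing coordinates up to the bounds \<open>u\<close>, so
  \<open>Q\<^sup>I\<close> consists of the points of \<open>conv V + \<real>\<^sup>n\<^sub>+\<close> that are \<open>\<le> u\<close>.
\<close>

section \<open>Fourier-Motzkin elimination\<close>

text \<open>Constraints with \<open>e c < 0\<close> bound \<open>t\<close> below by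
  \<open>p c / e c\<close>, those with \<open>e d > 0\<close> bound it above by
  \<open>p d / e d\<close>, and the pairs compare the two kinds after clearing denominators. The
  extra lower bound 0 paired with an upper bound gives \<open>0 \<le> p c\<close>; for
  \<open>e c = 0\<close> the constraint does not involve \<open>t\<close>.\<close>

lemma ex_nonneg_elimination:
  fixes p e :: "'c \<Rightarrow> real"
  assumes "finite C"
  shows "(\<exists>t\<ge>0. \<forall>c\<in>C. 0 \<le> p c - t * e c) \<longleftrightarrow>
    (\<forall>c\<in>C. 0 \<le> e c \<longrightarrow> 0 \<le> p c) \<and>
    (\<forall>c\<in>C. \<forall>d\<in>C. e c < 0 \<longrightarrow> 0 < e d \<longrightarrow> 0 \<le> e d * p c - e c * p d)"
    (is "?L \<longleftrightarrow> ?R")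
proof
  assume ?L
  then obtain t where t: "t \<ge> 0" "\<And>c. c \<in> C \<Longrightarrow> t * e c \<le> p c"
    by force
  show ?R
  proof (intro conjI ballI impI)
    fix c assume "c \<in> C" "0 \<le> e c"
    then show "0 \<le> p c"
      using t by (meson mult_nonneg_nonneg order_trans)
  next
    fix c d assume cd: "c \<in> C" "d \<in> C" "e c < 0" "0 < e d"
    have "e d * (t * e c) \<le> e d * p c" "- e c * (t * e d) \<le> - e c * p d"
      using t cd by (auto intro!: mult_left_mono mult_left_mono_neg)
    then show "0 \<le> e d * p c - e c * p d"
      by (simp add: algebra_simps)
  qed
next
  assume R: ?R
  \<comment> \<open>The largest lower bound meets all lower bounds by construction; each upper bound
    is then compared with the lower bound that attains the maximum.\<close>
  define t where "t = Max (insert 0 ((\<lambda>c. p c / e c) ` {c \<in> C. e c < 0}))"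
  have fin: "finite (insert 0 ((\<lambda>c. p c / e c) ` {c \<in> C. e c < 0}))"
    using assms by simp
  have tl: "p c / e c \<le> t" if "c \<in> C" "e c < 0" for c
    unfolding t_def using fin that by (auto intro!: Max_ge)
  have t0: "t \<ge> 0"
    unfolding t_def using fin by (auto intro!: Max_ge)
  have t_in: "t \<in> insert 0 ((\<lambda>c. p c / e c) ` {c \<in> C. e c < 0})"
    unfolding t_def using fin by (intro Max_in) auto
  have "0 \<le> p c - t * e c" if c: "c \<in> C" for c
  proof (cases "e c" "0 :: real" rule: linorder_cases)
    case less
    then show ?thesis
      using tl[OF c less] by (simp add: field_simps)
  next
    case equal
    then show ?thesis
      using R c by simp
  next
    case greater
    from t_in show ?thesis
    proof
      assume "t = 0"
      then show ?thesis
        using R c greater by auto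
    next
      assume "t \<in> (\<lambda>c. p c / e c) ` {c \<in> C. e c < 0}"
      then obtain d where d: "d \<in> C" "e d < 0" "t = p d / e d"
        by auto
      then have "0 \<le> e c * p d - e d * p c"
        using R c greater by blast
      moreover have "p d = t * e d"
        using d by simp
      ultimately have "e d * (t * e c) \<ge> e d * p c"
        by (simp add: algebra_simps)
      then show ?thesis
        using \<open>e d < 0\<close> by (simp add: mult_le_cancel_left)
    qed
  qed
  then show ?L
    using t0 by blast
qed

text \<open>
  The point \<open>(x, s)\<close> ranges over the cone generated by the \<open>(v, 1)\<close>, \<open>v \<in> M\<close>, and the \<open>(e\<^sub>j, 0)\<close>;
  its slice \<open>s = 1\<close> is \<open>conv M + \<real>\<^sup>n\<^sub>+\<close>.
\<close>
lemma homogenized_dominant_inequalities: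
  fixes M :: "(real ^ 'n) set"
  assumes "finite M" "\<forall>v\<in>M. \<forall>j. v $ j \<in> \<rat>"
  shows "\<exists>C :: ((real ^ 'n) \<times> real) set. finite C \<and>
    (\<forall>c\<in>C. (\<forall>j. fst c $ j \<in> \<rat> \<and> 0 \<le> fst c $ j) \<and> snd c \<in> \<rat>) \<and>
    (\<forall>x s. (\<exists>l. (\<forall>v\<in>M. 0 \<le> l v) \<and> (\<Sum>v\<in>M. l v *\<^sub>R v) \<le> x \<and> sum l M = s)
      \<longleftrightarrow> (\<forall>c\<in>C. 0 \<le> c \<bullet> (x, s)))"
  using assms
proof (induction M rule: finite_induct)
  case empty
  \<comment> \<open>Without generators the cone is \<open>x \<ge> 0\<close>, \<open>s = 0\<close>.
    The equation splits into two inequalities of opposite sign, which is harmless because only the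
    coefficients of \<open>x\<close> must be non-negative.\<close>
  define C :: "((real ^ 'n) \<times> real) set" where
    "C = insert (0, 1) (insert (0, -1) (range (\<lambda>j. (axis j 1, 0))))"
  have "finite C"
    by (simp add: C_def)
  moreover have "(\<forall>j. fst c $ j \<in> \<rat> \<and> 0 \<le> fst c $ j) \<and> snd c \<in> \<rat>" if "c \<in> C" for c
    using that by (auto simp: C_def axis_def)
  moreover have "(0 \<le> x \<and> 0 = s) \<longleftrightarrow> (\<forall>c\<in>C. 0 \<le> c \<bullet> (x, s))" for x s
    by (auto simp: C_def less_eq_vec_def inner_axis')
  ultimately show ?case
    by (intro exI[of _ C]) simp
next
  case (insert w M)
  have w_rat: "w $ j \<in> \<rat>" for j
    using insert.prems by simp
  have "\<forall>v\<in>M. \<forall>j. v $ j \<in> \<rat>"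
    using insert.prems by simp
  from insert.IH[OF this] obtain C :: "((real ^ 'n) \<times> real) set" where
    fin: "finite C" and
    rat: "\<forall>c\<in>C. (\<forall>j. fst c $ j \<in> \<rat> \<and> 0 \<le> fst c $ j) \<and> snd c \<in> \<rat>" and
    C: "\<forall>x s. (\<exists>l. (\<forall>v\<in>M. 0 \<le> l v) \<and> (\<Sum>v\<in>M. l v *\<^sub>R v) \<le> x \<and> sum l M = s)
      \<longleftrightarrow> (\<forall>c\<in>C. 0 \<le> c \<bullet> (x, s))"
    by (elim exE conjE) (rule that)
  note rat = bspec[OF rat]
  define e where "e c = c \<bullet> (w, 1 :: real)" for c
  \<comment> \<open>The multipliers \<open>e d\<close> and \<open>- e c\<close> are positive, so
    every new constraint is a non-negative combination of old ones and its coefficients of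
    \<open>x\<close> stay non-negative.\<close>
  define C' where "C' = {c \<in> C. 0 \<le> e c} \<union>
    (\<lambda>(c, d). e d *\<^sub>R c - e c *\<^sub>R d) ` ({c \<in> C. e c < 0} \<times> {d \<in> C. 0 < e d})"
  have e_rat: "e c \<in> \<rat>" if "c \<in> C" for c
    using rat[OF that] w_rat
    by (auto simp: e_def inner_prod_def inner_vec_def intro!: Rats_add Rats_sum Rats_mult)
  have "finite C'"
    using fin by (simp add: C'_def)
  moreover have "(\<forall>j. fst c $ j \<in> \<rat> \<and> 0 \<le> fst c $ j) \<and> snd c \<in> \<rat>" if "c \<in> C'" for c
    using that unfolding C'_def
  proof
    assume "c \<in> {c \<in> C. 0 \<le> e c}"
    then show ?thesis using rat by auto
  next
    assume "c \<in> (\<lambda>(c, d). e d *\<^sub>R c - e c *\<^sub>R d) ` ({c \<in> C. e c < 0} \<times> {d \<in> C. 0 < e d})"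
    then obtain a d where ad: "a \<in> C" "d \<in> C" "e a < 0" "0 < e d" and c: "c = e d *\<^sub>R a - e a *\<^sub>R d"
      by auto
    have "0 \<le> e d * fst a $ j" "e a * fst d $ j \<le> 0" for j
      using ad rat[of a] rat[of d] by (auto intro: mult_nonpos_nonneg)
    then have "0 \<le> fst c $ j" for j
      using c by (simp add: order_trans[of _ 0])
    then show ?thesis
      using rat ad e_rat by (auto simp: c intro!: Rats_diff Rats_mult)
  qed
  moreover have "(\<exists>l. (\<forall>v\<in>insert w M. 0 \<le> l v) \<and> (\<Sum>v\<in>insert w M. l v *\<^sub>R v) \<le> x
        \<and> sum l (insert w M) = s) \<longleftrightarrow> (\<forall>c\<in>C'. 0 \<le> c \<bullet> (x, s))" (is "?E \<longleftrightarrow> _") for x s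
  proof -
    \<comment> \<open>The weight \<open>t\<close> of the new generator \<open>w\<close> is the
      variable to eliminate; moving its contribution to the right leaves the system for
      \<open>M\<close> at \<open>(x - t w, s - t)\<close>.\<close>
    have "?E \<longleftrightarrow> (\<exists>t\<ge>0. \<exists>l. (\<forall>v\<in>M. 0 \<le> l v) \<and> (\<Sum>v\<in>M. l v *\<^sub>R v) \<le> x - t *\<^sub>R w
        \<and> sum l M = s - t)" (is "_ \<longleftrightarrow> ?F")
    proof
      assume ?E
      then obtain l where "\<forall>v\<in>insert w M. 0 \<le> l v" "(\<Sum>v\<in>insert w M. l v *\<^sub>R v) \<le> x"
        "sum l (insert w M) = s" by blast
      then show ?F
        using insert.hyps by (intro exI[of _ "l w"] conjI exI[of _ l]) (auto simp: algebra_simps)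
    next
      assume ?F
      then obtain t l where l: "t \<ge> 0" "\<forall>v\<in>M. 0 \<le> l v"
        "(\<Sum>v\<in>M. l v *\<^sub>R v) \<le> x - t *\<^sub>R w" "sum l M = s - t" by blast
      have "(\<Sum>v\<in>M. (l(w := t)) v *\<^sub>R v) = (\<Sum>v\<in>M. l v *\<^sub>R v)" "sum (l(w := t)) M = sum l M"
        using insert.hyps by (auto intro!: sum.cong)
      then show ?E
        using insert.hyps l by (intro exI[of _ "l(w := t)"]) (auto simp: algebra_simps)
    qed
    also have "\<dots> \<longleftrightarrow> (\<exists>t\<ge>0. \<forall>c\<in>C. 0 \<le> c \<bullet> (x - t *\<^sub>R w, s - t))"
      using C by simp
    also have "\<dots> \<longleftrightarrow> (\<exists>t\<ge>0. \<forall>c\<in>C. 0 \<le> c \<bullet> (x, s) - t * e c)"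
      by (simp add: e_def inner_prod_def algebra_simps)
    also have "\<dots> \<longleftrightarrow> (\<forall>c\<in>C'. 0 \<le> c \<bullet> (x, s))"
      unfolding ex_nonneg_elimination[OF fin] C'_def
      by (auto simp: inner_diff_left ball_Un simp del: inner_Pair)
    finally show ?thesis .
  qed
  ultimately show ?case
    by (intro exI[of _ C'] conjI[OF _ conjI] ballI allI)
qed

section \<open>Raising coordinates inside the integer hull\<close>

text \<open>The preimage of the hull under \<open>f\<close> is convex and contains \<open>S\<close>.
  This serves for maps that raise one coordinate, which are affine but in general not
  linear.\<close>

lemma affine_image_convex_hull_subset:
  fixes f :: "'a::real_vector \<Rightarrow> 'a"
  assumes "\<And>x y a b. 0 \<le> a \<Longrightarrow> 0 \<le> b \<Longrightarrow> a + b = 1 \<Longrightarrow> f (a *\<^sub>R x + b *\<^sub>R y) = a *\<^sub>R f x + b *\<^sub>R f y"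
    and "f ` S \<subseteq> S" and "x \<in> convex hull S"
  shows "f x \<in> convex hull S"
proof -
  have "convex {x. f x \<in> convex hull S}"
    by (intro convexI) (simp add: assms(1) convexD[OF convex_convex_hull])
  moreover have "S \<subseteq> {x. f x \<in> convex hull S}"
    using assms(2) hull_subset[of S convex] by blast
  ultimately have "convex hull S \<subseteq> {x. f x \<in> convex hull S}"
    by (rule hull_minimal[rotated])
  then show ?thesis
    using assms(3) by blast
qed

lemma polyhedron_with_bounds_mono:
  assumes "nonneg_rational_system m A b" "x \<in> polyhedron_with_bounds m A b u" "x \<le> y"
    and "\<And>j. ereal (y $ j) \<le> ereal_of_enat (u $ j)"
  shows "y \<in> polyhedron_with_bounds m A b u"
proof -
  have "A i \<bullet> x \<le> A i \<bullet> y" if "i < m" for i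
    using assms(1,3) that
    by (auto simp: nonneg_rational_system_def inner_vec_def less_eq_vec_def
        intro!: sum_mono mult_left_mono)
  then have "b i \<le> A i \<bullet> y" if "i < m" for i
    using assms(2) that by (auto simp: polyhedron_with_bounds_def intro: order_trans)
  moreover have "0 \<le> y $ j" for j
    using assms(2,3) by (auto simp: polyhedron_with_bounds_def less_eq_vec_def intro: order_trans)
  ultimately show ?thesis
    using assms(4) by (simp add: polyhedron_with_bounds_def)
qed

lemma convex_polyhedron_with_bounds: "convex (polyhedron_with_bounds m A b u)"
proof -
  have "convex {x :: real ^ 'a. 0 \<le> x $ j}" for j
    using convex_halfspace_ge[of 0 "axis j 1 :: real ^ 'a"] by (simp add: inner_axis')
  moreover have "convex {x :: real ^ 'a. ereal (x $ j) \<le> ereal_of_enat (u $ j)}" for j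
    using convex_halfspace_le[of "axis j 1 :: real ^ 'a"]
    by (cases "u $ j") (simp_all add: inner_axis')
  moreover have "polyhedron_with_bounds m A b u = (\<Inter>j. {x. 0 \<le> x $ j}) \<inter>
      (\<Inter>i\<in>{..<m}. {x. A i \<bullet> x \<ge> b i}) \<inter> (\<Inter>j. {x. ereal (x $ j) \<le> ereal_of_enat (u $ j)})"
    by (auto simp: polyhedron_with_bounds_def)
  ultimately show ?thesis
    by (simp only:) (intro convex_Int convex_INT ballI convex_halfspace_ge)
qed

text \<open>Replacing coordinate \<open>j\<close> by \<open>c\<close> directly could destroy
  integrality. Instead an affine map that preserves the integer points pushes \<open>p\<close> to a
  height \<open>d \<ge> c\<close>, and the wanted point lies on the segment from \<open>p\<close> to
  its image.\<close>

lemma integer_hull_increase_coordinate: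
  fixes A :: "nat \<Rightarrow> real ^ 'n"
  assumes sys: "nonneg_rational_system m A b"
    and p: "p \<in> integer_hull (polyhedron_with_bounds m A b u)"
    and c: "p $ j \<le> c" "ereal c \<le> ereal_of_enat (u $ j)"
  shows "(\<chi> i. if i = j then c else p $ i) \<in> integer_hull (polyhedron_with_bounds m A b u)"
proof -
  define S where "S = polyhedron_with_bounds m A b u \<inter> {x. \<forall>j. x $ j \<in> \<int>}"
  have p: "p \<in> convex hull S"
    using p by (simp add: integer_hull_def S_def)
  obtain d where d: "c \<le> d" "(\<chi> i. if i = j then d else p $ i) \<in> convex hull S"
  proof (cases "u $ j")
    case (enat k)
    \<comment> \<open>A finite bound is itself an integer, so setting coordinate \<open>j\<close> to
      it keeps points integral and feasible.\<close>
    define f :: "real ^ 'n \<Rightarrow> real ^ 'n" where "f x = (\<chi> i. if i = j then real k else x $ i)" for x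
    have "f x \<in> S" if "x \<in> S" for x
    proof -
      have "f x \<in> polyhedron_with_bounds m A b u"
      proof (rule polyhedron_with_bounds_mono[OF sys])
        show "x \<in> polyhedron_with_bounds m A b u"
          using that by (simp add: S_def)
        then have "ereal (x $ i) \<le> ereal_of_enat (u $ i)" for i
          by (simp add: polyhedron_with_bounds_def)
        from this this[of j] show "x \<le> f x" "\<And>i. ereal (f x $ i) \<le> ereal_of_enat (u $ i)"
          using enat by (auto simp: f_def less_eq_vec_def)
      qed
      then show ?thesis
        using that by (simp add: S_def f_def)
    qed
    moreover have "f (a *\<^sub>R x + b *\<^sub>R y) = a *\<^sub>R f x + b *\<^sub>R f y" if "a + b = 1" for a b x y
      using that by (simp add: f_def vec_eq_iff flip: distrib_right)
    ultimately have "f p \<in> convex hull S"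
      by (intro affine_image_convex_hull_subset[OF _ _ p, where f = f]) auto
    then show ?thesis
      using that[of k] c enat by (simp add: f_def)
  next
    case infinity
    \<comment> \<open>Without a bound, translation by any natural number keeps integer points
      feasible; this one is large enough to reach \<open>c\<close>.\<close>
    define N where "N = real (nat \<lceil>c - p $ j\<rceil>)"
    define f :: "real ^ 'n \<Rightarrow> real ^ 'n" where "f x = x + axis j N" for x
    have N: "0 \<le> N" "c - p $ j \<le> N"
      unfolding N_def by linarith+
    have "f x \<in> S" if "x \<in> S" for x
    proof -
      have "f x \<in> polyhedron_with_bounds m A b u"
      proof (rule polyhedron_with_bounds_mono[OF sys])
        show x: "x \<in> polyhedron_with_bounds m A b u"
          using that by (simp add: S_def)
        show "x \<le> f x"
          using N by (simp add: f_def less_eq_vec_def axis_def)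
        show "ereal (f x $ i) \<le> ereal_of_enat (u $ i)" for i
          using infinity x by (cases "i = j") (auto simp: f_def axis_def polyhedron_with_bounds_def)
      qed
      then show ?thesis
        using that by (auto simp: S_def f_def axis_def N_def)
    qed
    moreover have "f (a *\<^sub>R x + b *\<^sub>R y) = a *\<^sub>R f x + b *\<^sub>R f y" if "a + b = 1" for a b x y
      using that by (simp add: f_def algebra_simps flip: scaleR_add_left)
    ultimately have "f p \<in> convex hull S"
      by (intro affine_image_convex_hull_subset[OF _ _ p, where f = f]) auto
    moreover have "f p = (\<chi> i. if i = j then p $ j + N else p $ i)"
      by (simp add: f_def vec_eq_iff axis_def)
    ultimately show ?thesis
      using that[of "p $ j + N"] N by simp
  qed
  have "(\<chi> i. if i = j then c else p $ i) \<in> closed_segment p (\<chi> i. if i = j then d else p $ i)"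
  proof (cases "d = p $ j")
    case True
    then have "(\<chi> i. if i = j then c else p $ i) = p"
      using c d by (simp add: vec_eq_iff)
    then show ?thesis
      by simp
  next
    case False
    define t where "t = (c - p $ j) / (d - p $ j)"
    have "0 \<le> t" "t \<le> 1" "t * (d - p $ j) = c - p $ j"
      using False c d by (auto simp: t_def divide_simps)
    then show ?thesis
      unfolding closed_segment_def by (auto simp: vec_eq_iff algebra_simps intro!: exI[of _ t])
  qed
  also have "\<dots> \<subseteq> convex hull S"
    by (rule closed_segment_subset[OF p d(2) convex_convex_hull])
  finally show ?thesis
    by (simp add: integer_hull_def S_def)
qed

text \<open>Coordinates are raised one at a time; \<open>J\<close> collects those already moved from
  \<open>p\<close> to \<open>x\<close>.\<close>

lemma integer_hull_mono:
  fixes A :: "nat \<Rightarrow> real ^ 'n"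
  assumes sys: "nonneg_rational_system m A b"
    and p: "p \<in> integer_hull (polyhedron_with_bounds m A b u)"
    and x: "p \<le> x" "\<And>j. ereal (x $ j) \<le> ereal_of_enat (u $ j)"
  shows "x \<in> integer_hull (polyhedron_with_bounds m A b u)"
proof -
  have "(\<chi> i. if i \<in> J then x $ i else p $ i) \<in> integer_hull (polyhedron_with_bounds m A b u)"
    if "finite J" for J
    using that
  proof induction
    case empty
    then show ?case
      using p by simp
  next
    case (insert j J)
    let ?q = "\<chi> i. if i \<in> J then x $ i else p $ i"
    have "(\<chi> i. if i = j then x $ j else ?q $ i) \<in> integer_hull (polyhedron_with_bounds m A b u)"
      using insert x by (intro integer_hull_increase_coordinate[OF sys]) (auto simp: less_eq_vec_def)
    moreover have "(\<chi> i. if i = j then x $ j else ?q $ i) = (\<chi> i. if i \<in> insert j J then x $ i else p $ i)"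
      by (auto simp: vec_eq_iff)
    ultimately show ?case
      by simp
  qed
  from this[of UNIV] show ?thesis
    by simp
qed

section \<open>Truncation to a finite box\<close>

text \<open>\<open>N\<close> exceeds or equals every quotient \<open>b i / A i $ j\<close>. If a
  coordinate with positive coefficient in row \<open>i\<close> is cut to \<open>N\<close>, that
  single term already reaches \<open>b i\<close>; otherwise only coordinates with coefficient 0 are
  cut and the row value is unchanged.\<close>

lemma polyhedron_with_bounds_truncate:
  fixes A :: "nat \<Rightarrow> real ^ 'n"
  assumes sys: "nonneg_rational_system m A b"
  obtains N :: nat where "\<And>x. x \<in> polyhedron_with_bounds m A b u \<Longrightarrow>
    (\<chi> j. min (x $ j) (real N)) \<in> polyhedron_with_bounds m A b u"
proof -
  \<comment> \<open>A zero coefficient contributes the quotient 0 here; only positive coefficients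
    matter below.\<close>
  have fin: "finite ((\<lambda>(i, j). b i / A i $ j) ` ({..<m} \<times> UNIV))"
    by (intro finite_imageI finite_cartesian_product) simp_all
  obtain K where K: "\<forall>q\<in>(\<lambda>(i, j). b i / A i $ j) ` ({..<m} \<times> UNIV). q \<le> K"
    using bdd_above_finite[OF fin] unfolding bdd_above_def by blast
  define N where "N = nat \<lceil>K\<rceil>"
  have N: "b i \<le> A i $ j * real N" if "i < m" "0 < A i $ j" for i j
  proof -
    have "b i / A i $ j \<le> real N"
    proof -
      have "b i / A i $ j \<le> K"
        using K \<open>i < m\<close> by force
      then show ?thesis
        unfolding N_def by linarith
    qed
    then show ?thesis
      using that by (simp add: field_simps)
  qed
  have "(\<chi> j. min (x $ j) (real N)) \<in> polyhedron_with_bounds m A b u"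
    if x: "x \<in> polyhedron_with_bounds m A b u" for x
  proof -
    let ?y = "\<chi> j. min (x $ j) (real N)"
    have x0: "0 \<le> x $ j" and xu: "ereal (x $ j) \<le> ereal_of_enat (u $ j)" for j
      using x by (auto simp: polyhedron_with_bounds_def)
    have "b i \<le> A i \<bullet> ?y" if i: "i < m" for i
    proof (cases "\<exists>j. 0 < A i $ j \<and> real N < x $ j")
      case True
      then obtain j where j: "0 < A i $ j" "real N < x $ j"
        by blast
      have "b i \<le> A i $ j * ?y $ j"
        using N[OF i j(1)] j by simp
      also have "\<dots> \<le> (\<Sum>j\<in>UNIV. A i $ j * ?y $ j)"
        using sys i x0 by (intro member_le_sum) (auto simp: nonneg_rational_system_def)
      finally show ?thesis
        by (simp add: inner_vec_def)
    next
      case False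
      then have "A i $ j * x $ j = A i $ j * ?y $ j" for j
        using sys i by (force simp: nonneg_rational_system_def min_def not_less less_le)
      then have "A i \<bullet> ?y = A i \<bullet> x"
        by (simp only: inner_vec_def inner_real_def)
      then show ?thesis
        using x i by (simp add: polyhedron_with_bounds_def)
    qed
    moreover have "ereal (?y $ j) \<le> ereal_of_enat (u $ j)" for j
      using xu[of j] by (simp add: min_def order_trans[of _ "ereal (x $ j)"])
    ultimately show ?thesis
      using x0 by (simp add: polyhedron_with_bounds_def)
  qed
  then show ?thesis
    using that by blast
qed

lemma finite_integer_box:
  "finite {x :: real ^ 'n. \<forall>j. x $ j \<in> \<int> \<and> 0 \<le> x $ j \<and> x $ j \<le> real N}"
proof (rule finite_subset)
  show "finite (vec_lambda ` (UNIV \<rightarrow>\<^sub>E real_of_int ` {0..int N}) :: (real ^ 'n) set)"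
    by (intro finite_imageI finite_PiE) auto
  show "{x :: real ^ 'n. \<forall>j. x $ j \<in> \<int> \<and> 0 \<le> x $ j \<and> x $ j \<le> real N}
      \<subseteq> vec_lambda ` (UNIV \<rightarrow>\<^sub>E real_of_int ` {0..int N})"
  proof
    fix x :: "real ^ 'n" assume x: "x \<in> {x. \<forall>j. x $ j \<in> \<int> \<and> 0 \<le> x $ j \<and> x $ j \<le> real N}"
    have "x $ j \<in> real_of_int ` {0..int N}" for j
    proof -
      from x have "x $ j \<in> \<int>"
        by simp
      then obtain k where "x $ j = real_of_int k"
        by (rule Ints_cases)
      moreover have "0 \<le> x $ j" "x $ j \<le> real N"
        using x by auto
      ultimately show ?thesis
        by simp
    qed
    then have "vec_nth x \<in> UNIV \<rightarrow>\<^sub>E real_of_int ` {0..int N}"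
      by auto
    then show "x \<in> vec_lambda ` (UNIV \<rightarrow>\<^sub>E real_of_int ` {0..int N})"
      by (metis image_eqI vec_nth_inverse)
  qed
qed

section \<open>The integer hull as the part of the dominant within the bounds\<close>

theorem proposition8:
  fixes m :: nat
    and A :: "nat \<Rightarrow> real ^ 'n"
    and b :: "nat \<Rightarrow> real"
    and u :: "enat ^ 'n"
    and Q :: "(real ^ 'n) set"
  assumes "nonneg_rational_system m A b"
    and "Q = polyhedron_with_bounds m A b u"
    and "Q \<noteq> {}"
  shows "covering_polyhedron_with_bounds (integer_hull Q)
    \<and> (\<exists>m' A' b'. nonneg_rational_system m' A' b' \<and>
          integer_hull Q = polyhedron_with_bounds m' A' b' u)"
proof -
  obtain N :: nat where N: "\<And>x. x \<in> Q \<Longrightarrow> (\<chi> j. min (x $ j) (real N)) \<in> Q"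
    using polyhedron_with_bounds_truncate[OF assms(1)] assms(2) by metis
  define S where "S = Q \<inter> {x. \<forall>j. x $ j \<in> \<int>}"
  define V where "V = {x \<in> S. \<forall>j. x $ j \<le> real N}"
  have S_nonneg: "0 \<le> x $ j" if "x \<in> S" for x j
    using that assms(2) by (simp add: S_def polyhedron_with_bounds_def)
  have "finite V"
    by (rule finite_subset[OF _ finite_integer_box[of N]]) (auto simp: V_def S_nonneg, auto simp: S_def)
  have V_rat: "\<forall>v\<in>V. \<forall>j. v $ j \<in> \<rat>"
    using Ints_subset_Rats by (auto simp: V_def S_def)
  obtain C :: "((real ^ 'n) \<times> real) set" where
    finC: "finite C" and
    rat: "\<forall>c\<in>C. (\<forall>j. fst c $ j \<in> \<rat> \<and> 0 \<le> fst c $ j) \<and> snd c \<in> \<rat>" and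
    C: "\<forall>x s. (\<exists>l. (\<forall>v\<in>V. 0 \<le> l v) \<and> (\<Sum>v\<in>V. l v *\<^sub>R v) \<le> x \<and> sum l V = s)
      \<longleftrightarrow> (\<forall>c\<in>C. 0 \<le> c \<bullet> (x, s))"
    using homogenized_dominant_inequalities[OF \<open>finite V\<close> V_rat] by (elim exE conjE) (rule that)
  obtain f :: "nat \<Rightarrow> (real ^ 'n) \<times> real" and m' where f: "C = f ` {i. i < m'}"
    using finite_imp_nat_seg_image_inj_on[OF finC] by blast
  define A' where "A' i = fst (f i)" for i
  \<comment> \<open>The inequality from \<open>f i\<close> at \<open>s = 1\<close> has right-hand
    side \<open>- snd (f i)\<close>, possibly negative. Raising it to 0 changes nothing on
    \<open>x \<ge> 0\<close>, where the left-hand side is non-negative.\<close>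
  define b' where "b' i = max 0 (- snd (f i))" for i
  have sys': "nonneg_rational_system m' A' b'"
    using rat by (auto simp: nonneg_rational_system_def A'_def b'_def f max_def)
  have P: "x \<in> polyhedron_with_bounds m' A' b' u \<longleftrightarrow>
      (\<forall>j. 0 \<le> x $ j) \<and> (\<forall>j. ereal (x $ j) \<le> ereal_of_enat (u $ j)) \<and>
      (\<exists>l. (\<forall>v\<in>V. 0 \<le> l v) \<and> (\<Sum>v\<in>V. l v *\<^sub>R v) \<le> x \<and> sum l V = 1)" for x
  proof -
    have "b' i \<le> A' i \<bullet> x \<longleftrightarrow> 0 \<le> f i \<bullet> (x, 1)" if "i < m'" "\<forall>j. 0 \<le> x $ j" for i
    proof -
      have "0 \<le> A' i \<bullet> x"
        using sys' that by (auto simp: nonneg_rational_system_def inner_vec_def intro!: sum_nonneg)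
      then show ?thesis
        by (auto simp: b'_def A'_def inner_prod_def)
    qed
    then show ?thesis
      unfolding C[rule_format] f polyhedron_with_bounds_def by auto
  qed
  have "integer_hull Q = polyhedron_with_bounds m' A' b' u"
  proof
    have "s \<in> polyhedron_with_bounds m' A' b' u" if s: "s \<in> S" for s
    proof -
      \<comment> \<open>The truncation of \<open>s\<close> lies in \<open>V\<close> and below
        \<open>s\<close>, so all weight is put on it.\<close>
      define v where "v = (\<chi> j. min (s $ j) (real N))"
      have "v \<in> V"
        using s N by (auto simp: V_def S_def v_def min_def)
      moreover have "v \<le> s"
        by (simp add: v_def less_eq_vec_def)
      moreover have "(\<Sum>w\<in>V. (if w = v then 1 else 0) *\<^sub>R w) = (\<Sum>w\<in>V. if w = v then v else 0)"
        by (intro sum.cong) auto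
      ultimately have "\<exists>l. (\<forall>v\<in>V. 0 \<le> l v) \<and> (\<Sum>v\<in>V. l v *\<^sub>R v) \<le> s \<and> sum l V = 1"
        using \<open>finite V\<close> by (intro exI[of _ "\<lambda>w. if w = v then 1 else 0"]) simp
      then show ?thesis
        using s assms(2) unfolding P by (simp add: S_def polyhedron_with_bounds_def)
    qed
    then show "integer_hull Q \<subseteq> polyhedron_with_bounds m' A' b' u"
      unfolding integer_hull_def S_def[symmetric]
      by (intro hull_minimal convex_polyhedron_with_bounds) blast
  next
    show "polyhedron_with_bounds m' A' b' u \<subseteq> integer_hull Q"
    proof
      fix x assume "x \<in> polyhedron_with_bounds m' A' b' u"
      then obtain l where x: "\<And>j. ereal (x $ j) \<le> ereal_of_enat (u $ j)"
        and l: "\<forall>v\<in>V. 0 \<le> l v" "(\<Sum>v\<in>V. l v *\<^sub>R v) \<le> x" "sum l V = 1"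
        unfolding P by blast
      \<comment> \<open>This combination is a point of the integer hull below \<open>x\<close>;
        since \<open>x\<close> respects the bounds, it can be raised to \<open>x\<close>.\<close>
      have "(\<Sum>v\<in>V. l v *\<^sub>R v) \<in> convex hull V"
        using l \<open>finite V\<close> by (auto simp: convex_hull_finite)
      also have "\<dots> \<subseteq> integer_hull Q"
        unfolding integer_hull_def by (intro hull_mono) (auto simp: V_def S_def)
      finally show "x \<in> integer_hull Q"
        using integer_hull_mono[OF assms(1)] l(2) x assms(2) by blast
    qed
  qed
  then show ?thesis
    using sys' unfolding covering_polyhedron_with_bounds_def by blast
qed

end
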